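(* Let $\mathrm{P}\in\{\mathrm{ICK},\mathrm{ICKT},\mathrm{ICKS4}\}$ and let $\varphi,\psi$ be formulae. If $\vdash_{\mathrm{P}}\varphi\vee\psi$, then $\vdash_{\mathrm{P}}\varphi$ or $\vdash_{\mathrm{P}}\psi$.
   Context: Formulae over a finite non-empty set $\mathsf{A}$ of agents and atoms $\mathrm{Prop}$: $\varphi ::= \bot \mid p \mid \varphi\wedge\varphi\mid\varphi\vee\varphi\mid\varphi\to\varphi\mid K_a\varphi\mid C\varphi$; $E\varphi:=\bigwedge_aK_a\varphi$. Hilbert systems: axiom schemes Int (uniform substitution instances of intuitionistic propositional tautologies), $\mathsf{K}_a$: $K_a(\varphi\to\psi)\to(K_a\varphi\to K_a\psi)$, $\mathsf{T}_a$: $K_a\varphi\to\varphi$, $\mathsf{S4}_a$: $K_a\varphi\to K_aK_a\varphi$, Fix: $C\varphi\leftrightarrow(\varphi\wedge EC\varphi)$; rules MP, $\mathsf{Nec}_a$ (from $\varphi$ infer $K_a\varphi$), Mon (from $\varphi\to\psi$ infer $C\varphi\to C\psi$), Ind (from $\varphi\to E\varphi$ infer $\varphi\to C\varphi$). $\mathrm{ICK}$: Int, $\mathsf{K}_a$ for all $a$, Fix and all four rules; $\mathrm{ICKT}$ adds $\mathsf{T}_a$; $\mathrm{ICKS4}$ further adds $\mathsf{S4}_a$. $\vdash_{\mathrm{P}}\varphi$ means $\varphi$ has a finite derivation tree from axioms of $\mathrm{P}$ via its rules. *)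

theory Defs
  imports Main
begin

datatype ('a, 'p) fm =
    Bot
  | Atom 'p
  | And "('a, 'p) fm" "('a, 'p) fm"
  | Or "('a, 'p) fm" "('a, 'p) fm"
  | Imp "('a, 'p) fm" "('a, 'p) fm"
  | K 'a "('a, 'p) fm"
  | C "('a, 'p) fm"

abbreviation Iff :: "('a, 'p) fm \<Rightarrow> ('a, 'p) fm \<Rightarrow> ('a, 'p) fm" where
  "Iff \<phi> \<psi> \<equiv> And (Imp \<phi> \<psi>) (Imp \<psi> \<phi>)"

(* The value at the empty list is irrelevant: there is always at least one agent. *)
fun Conj :: "('a, 'p) fm list \<Rightarrow> ('a, 'p) fm" where
  "Conj [] = Imp Bot Bot"
| "Conj [\<phi>] = \<phi>"
| "Conj (\<phi> # \<psi> # \<chi>s) = And \<phi> (Conj (\<psi> # \<chi>s))"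

(* The finite non-empty set of agents is the type 'a of class finite. As conjunction is binary
   and formulae are not identified up to equivalence, the conjunction over all agents is taken
   along a fixed but arbitrary enumeration. *)
definition agents :: "'a::finite list" where
  "agents = (SOME as. distinct as \<and> set as = UNIV)"

lemma agents: "distinct (agents :: 'a::finite list)" "set (agents :: 'a list) = UNIV"
proof -
  have "\<exists>as :: 'a list. distinct as \<and> set as = UNIV"
    using finite_distinct_list[OF finite_UNIV] by blast
  then have "distinct (agents :: 'a list) \<and> set (agents :: 'a list) = UNIV"
    unfolding agents_def by (rule someI_ex)
  then show "distinct (agents :: 'a list)" "set (agents :: 'a list) = UNIV"
    by auto
qed

definition E :: "('a::finite, 'p) fm \<Rightarrow> ('a, 'p) fm" where
  "E \<phi> = Conj (map (\<lambda>a. K a \<phi>) agents)"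

(* Purely propositional formulae, with their own countable supply of variables: the axiom
   schemes must not depend on how many atoms there are in 'p. *)
datatype pfm =
    PBot
  | PVar nat
  | PAnd pfm pfm
  | POr pfm pfm
  | PImp pfm pfm

(* Intuitionistic propositional tautologies: the theorems of intuitionistic propositional logic,
   in a standard Hilbert-style axiomatisation. *)
inductive int_taut :: "pfm \<Rightarrow> bool" where
  "int_taut (PImp A (PImp B A))"
| "int_taut (PImp (PImp A (PImp B D)) (PImp (PImp A B) (PImp A D)))"
| "int_taut (PImp (PAnd A B) A)"
| "int_taut (PImp (PAnd A B) B)"
| "int_taut (PImp A (PImp B (PAnd A B)))"
| "int_taut (PImp A (POr A B))"
| "int_taut (PImp B (POr A B))"
| "int_taut (PImp (PImp A D) (PImp (PImp B D) (PImp (POr A B) D)))"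
| "int_taut (PImp PBot A)"
| "int_taut (PImp A B) \<Longrightarrow> int_taut A \<Longrightarrow> int_taut B"

primrec subst :: "(nat \<Rightarrow> ('a, 'p) fm) \<Rightarrow> pfm \<Rightarrow> ('a, 'p) fm" where
  "subst \<sigma> PBot = Bot"
| "subst \<sigma> (PVar n) = \<sigma> n"
| "subst \<sigma> (PAnd A B) = And (subst \<sigma> A) (subst \<sigma> B)"
| "subst \<sigma> (POr A B) = Or (subst \<sigma> A) (subst \<sigma> B)"
| "subst \<sigma> (PImp A B) = Imp (subst \<sigma> A) (subst \<sigma> B)"

datatype logic = ICK | ICKT | ICKS4

inductive derivable :: "logic \<Rightarrow> ('a::finite, 'p) fm \<Rightarrow> bool"  (infix "\<turnstile>" 50) for P where
  Int: "int_taut A \<Longrightarrow> P \<turnstile> subst \<sigma> A"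
| Kax: "P \<turnstile> Imp (K a (Imp \<phi> \<psi>)) (Imp (K a \<phi>) (K a \<psi>))"
| Tax: "P \<in> {ICKT, ICKS4} \<Longrightarrow> P \<turnstile> Imp (K a \<phi>) \<phi>"
| S4ax: "P = ICKS4 \<Longrightarrow> P \<turnstile> Imp (K a \<phi>) (K a (K a \<phi>))"
| Fix: "P \<turnstile> Iff (C \<phi>) (And \<phi> (E (C \<phi>)))"
| MP: "P \<turnstile> Imp \<phi> \<psi> \<Longrightarrow> P \<turnstile> \<phi> \<Longrightarrow> P \<turnstile> \<psi>"
| Nec: "P \<turnstile> \<phi> \<Longrightarrow> P \<turnstile> K a \<phi>"
| Mon: "P \<turnstile> Imp \<phi> \<psi> \<Longrightarrow> P \<turnstile> Imp (C \<phi>) (C \<psi>)"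
| Ind: "P \<turnstile> Imp \<phi> (E \<phi>) \<Longrightarrow> P \<turnstile> Imp \<phi> (C \<phi>)"

end

(* A Kleene-Aczel slash: a predicate on formulae that implies derivability, holds of a disjunction
   only if it holds of one of the disjuncts, and is preserved by all axioms and rules.  A formula
   "K a \<phi>" or "C \<phi>" is slashed iff it is derivable and \<phi> is slashed; no infinite unfolding of C is
   needed, because the induction rule is only ever applied to a formula already known to be
   derivable. *)
theory Submission
  imports Defs
begin

primrec slash :: "logic \<Rightarrow> ('a::finite, 'p) fm \<Rightarrow> bool" where
  "slash P Bot \<longleftrightarrow> False"
| "slash P (Atom p) \<longleftrightarrow> False"
| "slash P (And \<phi> \<psi>) \<longleftrightarrow> slash P \<phi> \<and> slash P \<psi>"
| "slash P (Or \<phi> \<psi>) \<longleftrightarrow> slash P \<phi> \<or> slash P \<psi>"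
| "slash P (Imp \<phi> \<psi>) \<longleftrightarrow> P \<turnstile> Imp \<phi> \<psi> \<and> (slash P \<phi> \<longrightarrow> slash P \<psi>)"
| "slash P (K a \<phi>) \<longleftrightarrow> P \<turnstile> K a \<phi> \<and> slash P \<phi>"
| "slash P (C \<phi>) \<longleftrightarrow> P \<turnstile> C \<phi> \<and> slash P \<phi>"

text \<open>\<open>Int\<close> speaks of substitution instances only; sending three variables to
  \<phi>, \<psi> and \<chi> turns the axioms of \<open>int_taut\<close> into schemes for arbitrary
  modal formulae.\<close>

lemma derivable_int_axioms:
  shows derivable_weaken: "P \<turnstile> Imp \<phi> (Imp \<psi> \<phi>)"
    and derivable_distrib: "P \<turnstile> Imp (Imp \<phi> (Imp \<psi> \<chi>)) (Imp (Imp \<phi> \<psi>) (Imp \<phi> \<chi>))"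
    and derivable_fst: "P \<turnstile> Imp (And \<phi> \<psi>) \<phi>"
    and derivable_snd: "P \<turnstile> Imp (And \<phi> \<psi>) \<psi>"
    and derivable_pair: "P \<turnstile> Imp \<phi> (Imp \<psi> (And \<phi> \<psi>))"
    and derivable_inl: "P \<turnstile> Imp \<phi> (Or \<phi> \<psi>)"
    and derivable_inr: "P \<turnstile> Imp \<psi> (Or \<phi> \<psi>)"
    and derivable_cases: "P \<turnstile> Imp (Imp \<phi> \<chi>) (Imp (Imp \<psi> \<chi>) (Imp (Or \<phi> \<psi>) \<chi>))"
    and derivable_absurd: "P \<turnstile> Imp Bot \<phi>"
proof -
  let ?\<sigma> = "\<lambda>n. if n = 0 then \<phi> else if n = 1 then \<psi> else \<chi>"
  let ?a = "PVar 0" and ?b = "PVar 1" and ?c = "PVar 2"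
  \<comment> \<open>Arguments follow the order in which the schematic variables first occur, hence
    \<open>?b ?a\<close> and \<open>?a ?c ?b\<close>.\<close>
  note instances = int_taut.intros(1)[of ?a ?b] int_taut.intros(2)[of ?a ?b ?c]
    int_taut.intros(3-6)[of ?a ?b] int_taut.intros(7)[of ?b ?a] int_taut.intros(8)[of ?a ?c ?b]
    int_taut.intros(9)[of ?a]
  note axioms = instances[THEN Int[where P = P and \<sigma> = ?\<sigma>], simplified]
  show "P \<turnstile> Imp \<phi> (Imp \<psi> \<phi>)"
    "P \<turnstile> Imp (Imp \<phi> (Imp \<psi> \<chi>)) (Imp (Imp \<phi> \<psi>) (Imp \<phi> \<chi>))"
    "P \<turnstile> Imp (And \<phi> \<psi>) \<phi>" "P \<turnstile> Imp (And \<phi> \<psi>) \<psi>" "P \<turnstile> Imp \<phi> (Imp \<psi> (And \<phi> \<psi>))"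
    "P \<turnstile> Imp \<phi> (Or \<phi> \<psi>)" "P \<turnstile> Imp \<psi> (Or \<phi> \<psi>)"
    "P \<turnstile> Imp (Imp \<phi> \<chi>) (Imp (Imp \<psi> \<chi>) (Imp (Or \<phi> \<psi>) \<chi>))" "P \<turnstile> Imp Bot \<phi>"
    by (rule axioms)+
qed

lemma slash_imp_derivable: "slash P \<phi> \<Longrightarrow> P \<turnstile> \<phi>"
  by (induction \<phi>) (auto intro: MP derivable_inl derivable_inr MP[OF MP[OF derivable_pair]])

lemma slash_Conj: "(\<And>\<phi>. \<phi> \<in> set \<phi>s \<Longrightarrow> slash P \<phi>) \<Longrightarrow> slash P (Conj \<phi>s)"
  by (induction \<phi>s rule: Conj.induct) (auto intro: derivable_absurd)

text \<open>A slashed \<phi> is derivable, so necessitation makes every \<open>K a \<phi>\<close>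
  derivable and thus slashed.\<close>

lemma slash_E: "slash P \<phi> \<Longrightarrow> slash P (E \<phi>)"
  unfolding E_def using Nec[OF slash_imp_derivable] by (intro slash_Conj) auto

text \<open>A slashed implication must be derivable, so each nested arrow of an axiom needs its own
  derivation: \<open>MP\<close> with the preceding antecedents, which are derivable because they are
  slashed.\<close>

lemma slash_subst_int_taut:
  assumes "int_taut A"
  shows "slash P (subst \<sigma> A)"
  using assms
proof induction
  case (10 A B)
  then show ?case by simp
qed (auto intro: derivable_int_axioms MP[OF derivable_weaken] MP[OF derivable_distrib]
    MP[OF MP[OF derivable_distrib]] MP[OF derivable_pair] MP[OF derivable_cases]
    MP[OF MP[OF derivable_cases]] slash_imp_derivable)

lemma slash_if_derivable: "P \<turnstile> \<phi> \<Longrightarrow> slash P \<phi>"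
proof (induction rule: derivable.induct)
  case (Int A \<sigma>)
  then show ?case by (rule slash_subst_int_taut)
next
  case (Kax a \<phi> \<psi>)
  then show ?case using derivable.Kax[of P a \<phi> \<psi>] by (auto intro: MP)
next
  case (Tax a \<phi>)
  then show ?case using derivable.Tax[of P a \<phi>] by auto
next
  case (S4ax a \<phi>)
  then show ?case using derivable.S4ax[of P a \<phi>] by (auto intro: Nec)
next
  case (Fix \<phi>)
  have unfold: "P \<turnstile> Imp (C \<phi>) (And \<phi> (E (C \<phi>)))" and fold: "P \<turnstile> Imp (And \<phi> (E (C \<phi>))) (C \<phi>)"
    by (rule MP[OF derivable_fst derivable.Fix], rule MP[OF derivable_snd derivable.Fix])
  have "P \<turnstile> C \<phi>" if "slash P (And \<phi> (E (C \<phi>)))"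
    using fold slash_imp_derivable[OF that] by (rule MP)
  \<comment> \<open>From left to right, \<open>slash_E\<close> is applied to
    \<open>C \<phi>\<close>; from right to left, \<phi> is already a slashed conjunct and only the
    derivability of \<open>C \<phi>\<close> is at stake.\<close>
  then show ?case using unfold fold by (auto intro: slash_E)
next
  case (Mon \<phi> \<psi>)
  then show ?case using derivable.Mon[of P \<phi> \<psi>] by (auto intro: MP)
next
  \<comment> \<open>If \<phi> is slashed, it is derivable, and \<open>MP\<close> with the conclusion
    of the rule derives \<open>C \<phi>\<close>; its slash then asks only for that of
    \<phi>.\<close>
  case (Ind \<phi>)
  then show ?case using derivable.Ind[of P \<phi>] by (auto intro: MP slash_imp_derivable)
qed (auto intro: Nec)

theorem mainTheorem10:
  fixes P :: logic and \<phi> \<psi> :: "('a::finite, 'p) fm"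
  assumes "P \<turnstile> Or \<phi> \<psi>"
  shows "P \<turnstile> \<phi> \<or> P \<turnstile> \<psi>"
  using slash_if_derivable[OF assms] slash_imp_derivable by auto

end
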